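(* Let $\mathcal H$ be an infinite-dimensional Hilbert space. A map $\sigma:B(\mathcal H)_+\times B(\mathcal H)_+\to B(\mathcal H)_+$ is an operator connection (in the sense of Kubo and Ando) if and only if $\sigma$ satisfies the following conditions: (I$'$) (joint operator concavity) $(A_1+A_2)\sigma(B_1+B_2)\ge(A_1\sigma B_1)+(A_2\sigma B_2)$ for all $A_i,B_i\in B(\mathcal H)_+$ ($i=1,2$); (II$'$) (transformer inequality) $C(A\sigma B)C\le(CAC)\sigma(CBC)$ for all $A,B,C\in B(\mathcal H)_+$; (III$'$) (upper continuity) if $A_n,B_n\in B(\mathcal H)_+$ ($n\in\mathbb N$), $A_n\searrow A$ and $B_n\searrow B$, then $A_n\sigma B_n\to A\sigma B$ in the strong operator topology.
   Context: $B(\mathcal H)_+$ is the set of positive bounded operators on $\mathcal H$. $A_n\searrow A$ means $A_1\ge A_2\ge\cdots$ and $A_n\to A$ in the strong operator topology. An operator connection (Kubo--Ando) is a map $\sigma:B(\mathcal H)_+\times B(\mathcal H)_+\to B(\mathcal H)_+$ satisfying: (I) $A_1\le A_2$ and $B_1\le B_2$ imply $A_1\sigma B_1\le A_2\sigma B_2$; (II) $C(A\sigma B)C\le(CAC)\sigma(CBC)$ for $A,B,C\in B(\mathcal H)_+$; (III) if $A_n\searrow A$ and $B_n\searrow B$ in $B(\mathcal H)_+$, then $A_n\sigma B_n\searrow A\sigma B$. *)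

theory Defs
  imports "HOL-Analysis.Analysis" "HOL-Library.FuncSet"
begin

section \<open>Complex Hilbert spaces\<close>

text \<open>
  Complex inner product spaces are introduced as real normed spaces whose scalar multiplication
  extends to the complex numbers and whose norm is induced by a complex inner product, linear in
  the first argument. The last axiom says both that the inner product is positive definite and
  that it induces the norm. Building on \<^class>\<open>real_normed_vector\<close> gives access to the
  library type of bounded operators.
\<close>

class complex_inner = real_normed_vector +
  fixes scaleC :: "complex \<Rightarrow> 'a \<Rightarrow> 'a"  (infixr \<open>*\<^sub>C\<close> 75)
    and cinner :: "'a \<Rightarrow> 'a \<Rightarrow> complex"
  assumes scaleC_add_right: "a *\<^sub>C (x + y) = a *\<^sub>C x + a *\<^sub>C y"
    and scaleC_add_left: "(a + b) *\<^sub>C x = a *\<^sub>C x + b *\<^sub>C x"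
    and scaleC_scaleC: "a *\<^sub>C b *\<^sub>C x = (a * b) *\<^sub>C x"
    and scaleC_of_real: "complex_of_real r *\<^sub>C x = r *\<^sub>R x"
    and cinner_commute: "cinner x y = cnj (cinner y x)"
    and cinner_add_left: "cinner (x + y) z = cinner x z + cinner y z"
    and cinner_scaleC_left: "cinner (a *\<^sub>C x) y = a * cinner x y"
    and cinner_self: "cinner x x = complex_of_real ((norm x)\<^sup>2)"

class complex_hilbert_space = complex_inner + complete_space

instance complex_hilbert_space \<subseteq> banach ..

interpretation complex_vector: vector_space "scaleC :: complex \<Rightarrow> 'a \<Rightarrow> 'a::complex_inner"
proof
  show "1 *\<^sub>C x = x" for x :: 'a
    using scaleC_of_real[of 1 x] by simp
qed (simp_all add: scaleC_add_right scaleC_add_left scaleC_scaleC)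

definition infinite_dimensional :: "'a::complex_inner itself \<Rightarrow> bool" where
  "infinite_dimensional _ \<longleftrightarrow>
    \<not> (\<exists>S::'a set. finite S \<and> complex_vector.span S = UNIV)"

instantiation complex :: complex_hilbert_space
begin

definition scaleC_complex :: "complex \<Rightarrow> complex \<Rightarrow> complex" where
  "scaleC_complex a x = a * x"

definition cinner_complex :: "complex \<Rightarrow> complex \<Rightarrow> complex" where
  "cinner_complex x y = x * cnj y"

instance
  by standard
    (simp_all add: scaleC_complex_def cinner_complex_def algebra_simps scaleR_conv_of_real
      complex_norm_square del: of_real_power)

end

section \<open>Positive operators\<close>

text \<open>
  The library type of bounded operators only requires real linearity, so complex linearity is part
  of the definition of a positive operator. Over the complex numbers, nonnegativity of the
  quadratic form already implies that the operator is self-adjoint.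
\<close>

definition clinear_op :: "('a::complex_inner \<Rightarrow>\<^sub>L 'a) \<Rightarrow> bool" where
  "clinear_op T \<longleftrightarrow> (\<forall>c x. T (c *\<^sub>C x) = c *\<^sub>C T x)"

definition positive_ops :: "('a::complex_inner \<Rightarrow>\<^sub>L 'a) set" where
  "positive_ops = {T. clinear_op T \<and> (\<forall>x. cinner (T x) x \<in> \<real>\<^sub>\<ge>\<^sub>0)}"

definition op_le :: "('a::complex_inner \<Rightarrow>\<^sub>L 'a) \<Rightarrow> ('a \<Rightarrow>\<^sub>L 'a) \<Rightarrow> bool"  (infix \<open>\<preceq>\<close> 50) where
  "S \<preceq> T \<longleftrightarrow> T - S \<in> positive_ops"

definition sot_tendsto :: "(nat \<Rightarrow> 'a::complex_inner \<Rightarrow>\<^sub>L 'a) \<Rightarrow> ('a \<Rightarrow>\<^sub>L 'a) \<Rightarrow> bool" where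
  "sot_tendsto T L \<longleftrightarrow> limitin strong_operator_topology T L sequentially"

definition sot_decreasing_to :: "(nat \<Rightarrow> 'a::complex_inner \<Rightarrow>\<^sub>L 'a) \<Rightarrow> ('a \<Rightarrow>\<^sub>L 'a) \<Rightarrow> bool" where
  "sot_decreasing_to T L \<longleftrightarrow> (\<forall>n. T (Suc n) \<preceq> T n) \<and> sot_tendsto T L"

section \<open>Operator connections\<close>

text \<open>
  A binary operation on positive operators is a function on all bounded operators that maps
  \<^const>\<open>positive_ops\<close> to itself in both arguments; its values elsewhere are never used.
\<close>

type_synonym 'a op_binary = "('a \<Rightarrow>\<^sub>L 'a) \<Rightarrow> ('a \<Rightarrow>\<^sub>L 'a) \<Rightarrow> ('a \<Rightarrow>\<^sub>L 'a)"

definition jointly_monotone :: "'a::complex_inner op_binary \<Rightarrow> bool" where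
  "jointly_monotone \<sigma> \<longleftrightarrow>
    (\<forall>A1\<in>positive_ops. \<forall>A2\<in>positive_ops. \<forall>B1\<in>positive_ops. \<forall>B2\<in>positive_ops.
      A1 \<preceq> A2 \<longrightarrow> B1 \<preceq> B2 \<longrightarrow> \<sigma> A1 B1 \<preceq> \<sigma> A2 B2)"

definition transformer_inequality :: "'a::complex_inner op_binary \<Rightarrow> bool" where
  "transformer_inequality \<sigma> \<longleftrightarrow>
    (\<forall>A\<in>positive_ops. \<forall>B\<in>positive_ops. \<forall>C\<in>positive_ops.
      C o\<^sub>L \<sigma> A B o\<^sub>L C \<preceq> \<sigma> (C o\<^sub>L A o\<^sub>L C) (C o\<^sub>L B o\<^sub>L C))"

definition decreasing_continuous :: "'a::complex_inner op_binary \<Rightarrow> bool" where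
  "decreasing_continuous \<sigma> \<longleftrightarrow>
    (\<forall>A B. \<forall>L\<in>positive_ops. \<forall>M\<in>positive_ops.
      (\<forall>n. A n \<in> positive_ops) \<longrightarrow> (\<forall>n. B n \<in> positive_ops) \<longrightarrow>
      sot_decreasing_to A L \<longrightarrow> sot_decreasing_to B M \<longrightarrow>
      sot_decreasing_to (\<lambda>n. \<sigma> (A n) (B n)) (\<sigma> L M))"

definition operator_connection :: "'a::complex_hilbert_space op_binary \<Rightarrow> bool" where
  "operator_connection \<sigma> \<longleftrightarrow>
    \<sigma> \<in> positive_ops \<rightarrow> positive_ops \<rightarrow> positive_ops \<and>
    jointly_monotone \<sigma> \<and> transformer_inequality \<sigma> \<and> decreasing_continuous \<sigma>"

text \<open>
  Joint concavity in the superadditive form, without the factors \<open>1/2\<close>.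
\<close>

definition jointly_concave :: "'a::complex_inner op_binary \<Rightarrow> bool" where
  "jointly_concave \<sigma> \<longleftrightarrow>
    (\<forall>A1\<in>positive_ops. \<forall>A2\<in>positive_ops. \<forall>B1\<in>positive_ops. \<forall>B2\<in>positive_ops.
      \<sigma> A1 B1 + \<sigma> A2 B2 \<preceq> \<sigma> (A1 + A2) (B1 + B2))"

text \<open>Unlike \<^const>\<open>decreasing_continuous\<close>, this does not require the values to decrease.\<close>

definition upper_continuous :: "'a::complex_inner op_binary \<Rightarrow> bool" where
  "upper_continuous \<sigma> \<longleftrightarrow>
    (\<forall>A B. \<forall>L\<in>positive_ops. \<forall>M\<in>positive_ops.
      (\<forall>n. A n \<in> positive_ops) \<longrightarrow> (\<forall>n. B n \<in> positive_ops) \<longrightarrow>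
      sot_decreasing_to A L \<longrightarrow> sot_decreasing_to B M \<longrightarrow>
      sot_tendsto (\<lambda>n. \<sigma> (A n) (B n)) (\<sigma> L M))"

end

theory Submission
  imports Defs
begin

text \<open>
  Concavity gives monotonicity because \<open>\<sigma> A2 B2\<close> dominates \<open>\<sigma> A1 B1 + \<sigma> (A2 - A1) (B2 - B1)\<close>.
  Conversely, superadditivity of a connection is checked on a single vector \<open>x\<close>. Compressed by a
  finite-rank projection \<open>Q\<close>, it follows from a direct sum argument, since infinite dimension leaves
  room for a copy of the range of \<open>Q\<close> in its orthogonal complement. The compressions are removed by
  letting \<open>Q\<close> increase to a projection that fixes \<open>x\<close> and whose range is invariant under \<open>A1 + A2\<close>
  and \<open>B1 + B2\<close>. A sequence of finite-rank projections need not reach the identity, because the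
  space may be nonseparable.
\<close>

section \<open>Inner products and positive operators\<close>

lemma cinner_zero_left [simp]: "cinner 0 x = 0"
  using cinner_add_left[of 0 0 x] by simp

lemma cinner_minus_left: "cinner (- x) y = - cinner x y"
  using cinner_add_left[of "- x" x y] by (simp add: eq_neg_iff_add_eq_0)

lemma cinner_diff_left: "cinner (x - y) z = cinner x z - cinner y z"
  using cinner_add_left[of x "- y" z] by (simp add: cinner_minus_left)

lemma cinner_add_right: "cinner z (x + y) = cinner z x + cinner z y"
  by (metis cinner_add_left cinner_commute complex_cnj_add)

lemma cinner_zero_right [simp]: "cinner x 0 = 0"
  by (metis cinner_zero_left cinner_commute complex_cnj_zero)

lemma cinner_diff_right: "cinner z (x - y) = cinner z x - cinner z y"
  by (metis cinner_diff_left cinner_commute complex_cnj_diff)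

lemma cinner_scaleC_right: "cinner x (a *\<^sub>C y) = cnj a * cinner x y"
  by (metis cinner_scaleC_left cinner_commute complex_cnj_mult)

lemma cinner_scaleR_left: "cinner (r *\<^sub>R x) y = of_real r * cinner x y"
  by (metis cinner_scaleC_left scaleC_of_real)

lemma cinner_scaleR_right: "cinner x (r *\<^sub>R y) = of_real r * cinner x y"
  by (metis cinner_scaleC_right scaleC_of_real complex_cnj_complex_of_real)

lemmas cinner_simps = cinner_add_left cinner_add_right cinner_diff_left cinner_diff_right
  cinner_scaleC_left cinner_scaleC_right cinner_scaleR_left cinner_scaleR_right

lemma Re_cinner_self: "Re (cinner x x) = (norm x)\<^sup>2"
  by (simp add: cinner_self)

text \<open>The class axioms make the norm homogeneous for real scalars only; complex scalars are
  handled through the inner product.\<close>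

lemma norm_scaleC: "norm (a *\<^sub>C x) = cmod a * norm (x :: 'a::complex_inner)"
proof -
  have "cinner (a *\<^sub>C x) (a *\<^sub>C x) = of_real ((cmod a)\<^sup>2 * (norm x)\<^sup>2)"
    by (simp add: cinner_scaleC_left cinner_scaleC_right cinner_self[of x] complex_norm_square
        mult.assoc del: of_real_power)
  then have "(norm (a *\<^sub>C x))\<^sup>2 = (cmod a * norm x)\<^sup>2"
    by (metis cinner_self of_real_eq_iff power_mult_distrib)
  then show ?thesis
    by (simp add: power2_eq_iff_nonneg)
qed

text \<open>Cauchy-Schwarz: the squared distance from \<open>x\<close> to its projection
  \<open>a *\<^sub>C y\<close> onto the complex line through \<open>y\<close> is
  nonnegative.\<close>

lemma cmod_cinner_le: "cmod (cinner x y) \<le> norm x * norm (y :: 'a::complex_inner)"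
proof (cases "y = 0")
  case False
  define a where "a = cinner x y / of_real ((norm y)\<^sup>2)"
  have "cinner (x - a *\<^sub>C y) (x - a *\<^sub>C y) = cinner x x - a * cnj (cinner x y)
      - cnj a * cinner x y + a * cnj a * cinner y y"
    using cinner_commute[of y x] by (simp add: cinner_simps algebra_simps)
  also have "\<dots> = of_real ((norm x)\<^sup>2 - (cmod (cinner x y))\<^sup>2 / (norm y)\<^sup>2)"
    using False
    by (simp add: a_def cinner_self complex_norm_square[symmetric] field_simps power2_eq_square)
  finally have "(norm (x - a *\<^sub>C y))\<^sup>2 = (norm x)\<^sup>2 - (cmod (cinner x y))\<^sup>2 / (norm y)\<^sup>2"
    by (metis cinner_self of_real_eq_iff)
  then have "(cmod (cinner x y))\<^sup>2 / (norm y)\<^sup>2 \<le> (norm x)\<^sup>2"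
    by (metis diff_ge_0_iff_ge zero_le_power2)
  then have "(cmod (cinner x y))\<^sup>2 \<le> (norm x * norm y)\<^sup>2"
    using False by (simp add: field_simps power_mult_distrib)
  then show ?thesis
    by (rule power2_le_imp_le) simp
qed simp

section \<open>Real quadratic forms and the operator order\<close>

definition qform :: "('a::complex_inner \<Rightarrow>\<^sub>L 'a) \<Rightarrow> 'a \<Rightarrow> real" where
  "qform T x = Re (cinner (T x) x)"

lemma qform_add: "qform (S + T) x = qform S x + qform T x"
  by (simp add: qform_def blinfun.add_left cinner_add_left)

lemma qform_diff: "qform (S - T) x = qform S x - qform T x"
  by (simp add: qform_def blinfun.diff_left cinner_diff_left)

lemma qform_scaleR: "qform (r *\<^sub>R T) x = r * qform T x"
  by (simp add: qform_def blinfun.scaleR_left cinner_scaleR_left)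

lemma qform_scaleR_arg: "qform T (r *\<^sub>R x) = r\<^sup>2 * qform T x"
  by (simp add: qform_def blinfun.scaleR_right cinner_simps power2_eq_square mult.assoc)

lemma qform_le: "qform T x \<le> norm T * (norm x)\<^sup>2"
proof -
  have "qform T x \<le> norm (T x) * norm x"
    unfolding qform_def using complex_Re_le_cmod cmod_cinner_le order_trans by blast
  also have "\<dots> \<le> (norm T * norm x) * norm x"
    by (simp add: mult_right_mono norm_blinfun)
  finally show ?thesis
    by (simp add: power2_eq_square mult.assoc)
qed

lemma scaleC_scaleR_commute: "c *\<^sub>C (r *\<^sub>R x) = r *\<^sub>R (c *\<^sub>C x)"
  by (metis scaleC_of_real scaleC_scaleC mult.commute)

lemma scaleC_diff_right: "c *\<^sub>C (x - y) = c *\<^sub>C x - c *\<^sub>C y"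
  by (rule complex_vector.scale_right_diff_distrib)

lemma clinear_op_add: "clinear_op S \<Longrightarrow> clinear_op T \<Longrightarrow> clinear_op (S + T)"
  by (simp add: clinear_op_def blinfun.add_left scaleC_add_right)

lemma clinear_op_diff: "clinear_op S \<Longrightarrow> clinear_op T \<Longrightarrow> clinear_op (S - T)"
  by (simp add: clinear_op_def blinfun.diff_left scaleC_diff_right)

lemma clinear_op_scaleR: "clinear_op T \<Longrightarrow> clinear_op (r *\<^sub>R T)"
  by (simp add: clinear_op_def blinfun.scaleR_left scaleC_scaleR_commute)

lemma clinear_op_compose: "clinear_op S \<Longrightarrow> clinear_op T \<Longrightarrow> clinear_op (S o\<^sub>L T)"
  by (simp add: clinear_op_def)

lemma clinear_op_id: "clinear_op id_blinfun"
  by (simp add: clinear_op_def)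

lemma positive_opsD:
  assumes "T \<in> positive_ops"
  shows "clinear_op T" "0 \<le> qform T x" "Im (cinner (T x) x) = 0"
  using assms by (auto simp: positive_ops_def qform_def complex_nonneg_Reals_iff)

text \<open>Polarization: a complex sesquilinear form with real diagonal is Hermitian.\<close>

lemma positive_ops_adjoint:
  assumes "T \<in> positive_ops"
  shows "cinner (T x) y = cinner x (T y)"
proof -
  note real = positive_opsD(3)[OF assms]
  have c: "T (\<i> *\<^sub>C y) = \<i> *\<^sub>C T y"
    using positive_opsD(1)[OF assms] by (simp add: clinear_op_def)
  \<comment> \<open>Reality of the form at \<open>x + y\<close> relates the imaginary parts of the
    two cross terms; at \<open>x + \<i> *\<^sub>C y\<close> it relates their real parts.\<close>
  have "Im (cinner (T x) y) + Im (cinner (T y) x) = 0"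
    using real[of "x + y"] real[of x] real[of y]
    by (simp add: blinfun.add_right cinner_simps)
  moreover have "Re (cinner (T y) x) = Re (cinner (T x) y)"
    using real[of "x + \<i> *\<^sub>C y"] real[of x] real[of y]
    by (simp add: blinfun.add_right c cinner_simps)
  ultimately have "cinner (T x) y = cnj (cinner (T y) x)"
    by (simp add: complex_eq_iff)
  then show ?thesis
    by (metis cinner_commute)
qed

text \<open>Symmetry forces a real diagonal, and it is easier to check for sums, congruences and
  projections than reality itself.\<close>

lemma positive_opsI:
  assumes "clinear_op T" "\<And>x y. cinner (T x) y = cinner x (T y)" "\<And>x. 0 \<le> qform T x"
  shows "T \<in> positive_ops"
proof -
  have "Im (cinner (T x) x) = 0" for x
  proof -
    have "cinner (T x) x = cnj (cinner (T x) x)"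
      by (metis assms(2) cinner_commute)
    then show ?thesis
      by (simp add: complex_eq_iff)
  qed
  with assms show ?thesis
    by (auto simp: positive_ops_def qform_def complex_nonneg_Reals_iff)
qed

text \<open>The difference inherits linearity and symmetry, so only the sign of a real form is left.
  Later operator inequalities are therefore proved vector by vector.\<close>

lemma op_le_iff:
  assumes "S \<in> positive_ops" "T \<in> positive_ops"
  shows "S \<preceq> T \<longleftrightarrow> (\<forall>x. qform S x \<le> qform T x)"
proof
  assume "S \<preceq> T"
  then show "\<forall>x. qform S x \<le> qform T x"
    by (metis op_le_def positive_opsD(2) qform_diff diff_ge_0_iff_ge)
next
  assume "\<forall>x. qform S x \<le> qform T x"
  then show "S \<preceq> T"
    unfolding op_le_def using assms
    by (intro positive_opsI)
      (auto simp: positive_opsD clinear_op_diff blinfun.diff_left cinner_simps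
        positive_ops_adjoint qform_diff)
qed

lemma positive_ops_add: "S \<in> positive_ops \<Longrightarrow> T \<in> positive_ops \<Longrightarrow> S + T \<in> positive_ops"
  by (intro positive_opsI)
    (auto simp: positive_opsD clinear_op_add blinfun.add_left cinner_simps
      positive_ops_adjoint qform_add)

lemma positive_ops_scaleR: "T \<in> positive_ops \<Longrightarrow> 0 \<le> r \<Longrightarrow> r *\<^sub>R T \<in> positive_ops"
  by (intro positive_opsI)
    (auto simp: positive_opsD clinear_op_scaleR blinfun.scaleR_left cinner_simps
      positive_ops_adjoint qform_scaleR)

lemma positive_ops_zero: "0 \<in> positive_ops"
  by (intro positive_opsI) (auto simp: clinear_op_def qform_def)

lemma positive_ops_sum: "(\<And>i. i \<in> I \<Longrightarrow> f i \<in> positive_ops) \<Longrightarrow> sum f I \<in> positive_ops"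
  by (induction I rule: infinite_finite_induct) (auto simp: positive_ops_zero positive_ops_add)

lemma positive_ops_id: "id_blinfun \<in> positive_ops"
  by (intro positive_opsI) (auto simp: clinear_op_id qform_def Re_cinner_self)

section \<open>Congruences and orthogonal projections\<close>

abbreviation congr_op :: "('a::complex_inner \<Rightarrow>\<^sub>L 'a) \<Rightarrow> ('a \<Rightarrow>\<^sub>L 'a) \<Rightarrow> ('a \<Rightarrow>\<^sub>L 'a)" where
  "congr_op C A \<equiv> C o\<^sub>L A o\<^sub>L C"

lemma qform_congr: "C \<in> positive_ops \<Longrightarrow> qform (congr_op C A) x = qform A (C x)"
  by (simp add: qform_def positive_ops_adjoint)

lemma positive_ops_congr:
  "C \<in> positive_ops \<Longrightarrow> A \<in> positive_ops \<Longrightarrow> congr_op C A \<in> positive_ops"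
  by (intro positive_opsI)
    (auto simp: positive_opsD clinear_op_compose positive_ops_adjoint qform_congr)

lemma positive_ops_projection:
  assumes "clinear_op P" "\<And>x y. cinner (P x) y = cinner x (P y)" "\<And>x. P (P x) = P x"
  shows "P \<in> positive_ops" "qform P x = (norm (P x))\<^sup>2"
proof -
  show q: "qform P x = (norm (P x))\<^sup>2" for x
    by (metis assms(2,3) Re_cinner_self qform_def)
  show "P \<in> positive_ops"
    using assms(1,2) by (intro positive_opsI) (auto simp: q)
qed

lemma projection_complement:
  assumes "P \<in> positive_ops" "\<And>x. P (P x) = P x"
  shows "id_blinfun - P \<in> positive_ops"
    and "qform (id_blinfun - P) x = (norm (x - P x))\<^sup>2"
proof -
  have "clinear_op (id_blinfun - P)"
    by (simp add: clinear_op_diff clinear_op_id positive_opsD(1)[OF assms(1)])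
  moreover have "cinner ((id_blinfun - P) x) y = cinner x ((id_blinfun - P) y)" for x y
    by (simp add: blinfun.diff_left cinner_simps positive_ops_adjoint[OF assms(1)])
  moreover have "(id_blinfun - P) ((id_blinfun - P) x) = (id_blinfun - P) x" for x
    by (simp add: blinfun.diff_left blinfun.diff_right assms(2))
  ultimately have "id_blinfun - P \<in> positive_ops"
    "qform (id_blinfun - P) x = (norm ((id_blinfun - P) x))\<^sup>2"
    using positive_ops_projection by blast+
  then show "id_blinfun - P \<in> positive_ops"
    "qform (id_blinfun - P) x = (norm (x - P x))\<^sup>2"
    by (simp_all add: blinfun.diff_left)
qed

text \<open>Along the line \<open>u + t *\<^sub>R v\<close> the form is a quadratic polynomial in
  \<open>t\<close> with minimum at 0, so its linear coefficient, twice the real part of the cross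
  term, vanishes.\<close>

lemma qform_add_orthogonal:
  assumes "X \<in> positive_ops" "\<And>t. qform X u \<le> qform X (u + t *\<^sub>R v)"
  shows "qform X (u + v) = qform X u + qform X v"
proof -
  define b where "b = 2 * Re (cinner (X u) v)"
  have e: "qform X (u + t *\<^sub>R v) = qform X u + t * b + t\<^sup>2 * qform X v" for t
  proof -
    have "cinner (X v) u = cnj (cinner (X u) v)"
      by (metis assms(1) positive_ops_adjoint cinner_commute)
    then show ?thesis
      by (simp add: b_def qform_def blinfun.add_right blinfun.scaleR_right cinner_simps
          algebra_simps power2_eq_square)
  qed
  have ge: "0 \<le> t * b + t\<^sup>2 * qform X v" for t
    using assms(2)[of t] e[of t] by simp
  \<comment> \<open>Adding 1 keeps the divisor positive when \<open>qform X v = 0\<close>; at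
    \<open>t = - b / k\<close> the nonnegative quantity equals
    \<open>- (b / k)\<^sup>2\<close>.\<close>
  define k where "k = qform X v + 1"
  have k: "k > 0"
    using positive_opsD(2)[OF assms(1), of v] by (simp add: k_def)
  have "0 \<le> (- b / k) * b + (- b / k)\<^sup>2 * (k - 1)"
    using ge[of "- b / k"] by (simp add: k_def)
  also have "\<dots> = - (b / k)\<^sup>2"
    using k by (simp add: power2_eq_square field_simps)
  finally have "b = 0"
    using k by simp
  then show ?thesis
    using e[of 1] by simp
qed

section \<open>Finite orthonormal sets\<close>

definition orthonormal :: "'a::complex_inner set \<Rightarrow> bool" where
  "orthonormal E \<longleftrightarrow> (\<forall>e\<in>E. \<forall>f\<in>E. cinner e f = (if e = f then 1 else 0))"

text \<open>The projection onto the complex line of \<open>e\<close>, multiplied by the squared norm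
  of \<open>e\<close>. Leaving it unnormalized suits the sums \<open>e + h e\<close> used for the
  folding operator.\<close>

lift_definition rank_one :: "'a::complex_inner \<Rightarrow> 'a \<Rightarrow>\<^sub>L 'a" is "\<lambda>e x. cinner x e *\<^sub>C e"
proof (rule bounded_linear_intro)
  fix e x y :: 'a and r :: real
  show "cinner (x + y) e *\<^sub>C e = cinner x e *\<^sub>C e + cinner y e *\<^sub>C e"
    by (simp add: cinner_add_left scaleC_add_left)
  show "cinner (r *\<^sub>R x) e *\<^sub>C e = r *\<^sub>R (cinner x e *\<^sub>C e)"
    by (metis cinner_scaleR_left scaleC_of_real scaleC_scaleC)
  show "norm (cinner x e *\<^sub>C e) \<le> norm x * (norm e * norm e)"
    using mult_right_mono[OF cmod_cinner_le[of x e], of "norm e"]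
    by (simp add: norm_scaleC mult.assoc)
qed

lemma qform_rank_one: "qform (rank_one e) x = (cmod (cinner x e))\<^sup>2"
  using cinner_commute[of e x]
  by (simp add: qform_def rank_one.rep_eq cinner_simps complex_norm_square[symmetric] del: of_real_power)

lemma positive_ops_rank_one: "rank_one e \<in> positive_ops"
proof (rule positive_opsI)
  show "clinear_op (rank_one e)"
    by (simp add: clinear_op_def rank_one.rep_eq cinner_simps scaleC_scaleC)
  show "cinner (rank_one e x) y = cinner x (rank_one e y)" for x y
    using cinner_commute[of e y] by (simp add: rank_one.rep_eq cinner_simps)
qed (simp add: qform_rank_one)

text \<open>The orthogonal projection onto the span when \<open>E\<close> is finite and orthonormal;
  for infinite \<open>E\<close> the sum takes the default value 0.\<close>

definition proj :: "'a::complex_inner set \<Rightarrow> 'a \<Rightarrow>\<^sub>L 'a" where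
  "proj E = (\<Sum>e\<in>E. rank_one e)"

lemma proj_apply: "proj E x = (\<Sum>e\<in>E. cinner x e *\<^sub>C e)"
  by (simp add: proj_def blinfun.sum_left rank_one.rep_eq)

lemma positive_ops_proj: "proj E \<in> positive_ops"
  unfolding proj_def by (intro positive_ops_sum positive_ops_rank_one)

lemma proj_fix:
  assumes "finite E" "orthonormal E" "e \<in> E"
  shows "proj E e = e"
proof -
  have "proj E e = (\<Sum>f\<in>E. if f = e then e else 0)"
    unfolding proj_apply using assms by (intro sum.cong) (auto simp: orthonormal_def)
  then show ?thesis
    using assms by simp
qed

lemma blinfun_scaleC: "clinear_op T \<Longrightarrow> T (c *\<^sub>C x) = c *\<^sub>C T x"
  by (simp add: clinear_op_def)

text \<open>By complex linearity, an operator identity on the range of \<open>proj E\<close> only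
  has to be checked on basis vectors.\<close>

lemma eq_on_proj:
  assumes "clinear_op S" "clinear_op T" "\<And>e. e \<in> E \<Longrightarrow> S e = T e"
  shows "S (proj E x) = T (proj E x)"
  using assms by (simp add: proj_apply blinfun.sum_right blinfun_scaleC)

lemma proj_proj_subset:
  assumes "finite E" "orthonormal E" "D \<subseteq> E"
  shows "proj E (proj D x) = proj D x"
proof -
  have "proj E e = id_blinfun e" if "e \<in> D" for e
    using proj_fix[of E e] assms that by auto
  from eq_on_proj[OF positive_opsD(1)[OF positive_ops_proj] clinear_op_id this]
  show ?thesis
    by simp
qed

lemma cinner_proj_complement:
  assumes "finite E" "orthonormal E" "e \<in> E"
  shows "cinner (x - proj E x) e = 0"
  by (simp add: cinner_diff_left positive_ops_adjoint[OF positive_ops_proj] proj_fix[OF assms])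

text \<open>One Gram-Schmidt step: \<open>w\<close> is the component of \<open>x\<close> orthogonal
  to \<open>E\<close>, and the last equation puts \<open>x\<close> into the enlarged span.\<close>

lemma orthonormal_insert_normalized:
  assumes "finite E" "orthonormal E" "x \<noteq> proj E x"
  defines "w \<equiv> x - proj E x"
  defines "u \<equiv> (1 / norm w) *\<^sub>R w"
  shows "orthonormal (insert u E)" "u \<notin> E" "x = proj E x + norm w *\<^sub>R u"
proof -
  have w: "norm w > 0"
    using assms by simp
  have ue: "cinner u e = 0" "cinner e u = 0" if "e \<in> E" for e
  proof -
    show "cinner u e = 0"
      using cinner_proj_complement[OF assms(1,2) that] by (simp add: u_def w_def cinner_simps)
    then show "cinner e u = 0"
      by (metis cinner_commute complex_cnj_zero)
  qed
  have uu: "cinner u u = 1"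
    using w by (simp add: u_def cinner_self)
  show "u \<notin> E"
    using ue uu by force
  then show "orthonormal (insert u E)"
    using ue uu assms(2) by (auto simp: orthonormal_def)
  show "x = proj E x + norm w *\<^sub>R u"
    using w by (simp add: u_def) (simp add: w_def)
qed

text \<open>Iterated Gram-Schmidt. Being fixed by \<open>proj E'\<close> encodes membership in the
  span of \<open>E'\<close>.\<close>

lemma orthonormal_extend:
  assumes "finite V" "finite E" "orthonormal E"
  shows "\<exists>E'. E \<subseteq> E' \<and> finite E' \<and> orthonormal E' \<and> (\<forall>v\<in>V. proj E' v = v)"
  using assms(1)
proof (induction V rule: finite_induct)
  case empty
  then show ?case
    using assms by auto
next
  case (insert x V)
  then obtain F where F: "E \<subseteq> F" "finite F" "orthonormal F" "\<forall>v\<in>V. proj F v = v"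
    by blast
  show ?case
  proof (cases "x = proj F x")
    case True
    then show ?thesis
      using F by (intro exI[of _ F]) auto
  next
    case False
    define w where "w = x - proj F x"
    define u where "u = (1 / norm w) *\<^sub>R w"
    note u = orthonormal_insert_normalized[OF F(2,3) False, folded w_def, folded u_def]
    let ?G = "insert u F"
    have fin: "finite ?G"
      using F by simp
    have le: "proj ?G (proj F v) = proj F v" for v
      by (rule proj_proj_subset) (use fin u in auto)
    have "proj ?G v = v" if "v \<in> V" for v
      using le[of v] F(4) that by simp
    moreover have "proj ?G x = x"
    proof -
      have "proj ?G x = proj ?G (proj F x) + norm w *\<^sub>R proj ?G u"
        by (subst u(3)) (simp add: blinfun.add_right blinfun.scaleR_right)
      also have "\<dots> = x"
        using u(3) proj_fix[OF fin u(1), of u] le by simp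
      finally show ?thesis .
    qed
    ultimately show ?thesis
      using F fin u by (intro exI[of _ ?G]) auto
  qed
qed

text \<open>Infinite dimension enters here: a finite set never spans the space, so a further
  Gram-Schmidt step is always possible.\<close>

lemma orthonormal_disjoint_copy:
  assumes "infinite_dimensional TYPE('a::complex_inner)" "finite E" "orthonormal (E :: 'a set)"
  shows "\<exists>F. finite F \<and> card F = n \<and> E \<inter> F = {} \<and> orthonormal (E \<union> F)"
proof (induction n)
  case 0
  then show ?case
    using assms by (intro exI[of _ "{}"]) auto
next
  case (Suc n)
  then obtain F where F: "finite F" "card F = n" "E \<inter> F = {}" "orthonormal (E \<union> F)"
    by blast
  let ?G = "E \<union> F"
  have G: "finite ?G"
    using F assms by simp
  then have "complex_vector.span ?G \<noteq> UNIV"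
    using assms(1) by (auto simp: infinite_dimensional_def)
  then obtain x where x: "x \<notin> complex_vector.span ?G"
    by auto
  have "proj ?G x \<in> complex_vector.span ?G"
    unfolding proj_apply
    by (intro complex_vector.span_sum complex_vector.span_scale complex_vector.span_base)
  then have "x \<noteq> proj ?G x"
    using x by auto
  from orthonormal_insert_normalized[OF G F(4) this]
  obtain u where "u \<notin> ?G" "orthonormal (insert u ?G)"
    by blast
  then show ?case
    using F by (intro exI[of _ "insert u F"]) auto
qed

lemma proj_orthogonal:
  assumes "\<And>e. e \<in> E \<Longrightarrow> cinner x e = 0"
  shows "proj E x = 0"
  using assms by (simp add: proj_apply)

section \<open>Strong limits of finite-rank projections\<close>

text \<open>The strong operator topology is the pullback of the product topology on functions, whose
  limits are taken pointwise.\<close>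

lemma sot_tendsto_iff: "sot_tendsto T L \<longleftrightarrow> (\<forall>x. (\<lambda>n. T n x) \<longlonglongrightarrow> L x)"
proof
  assume "sot_tendsto T L"
  then have "limitin euclidean ((\<lambda>f. blinfun_apply f x) \<circ> T) (L x) sequentially" for x
    unfolding sot_tendsto_def
    by (rule continuous_map_limit[OF strong_operator_topology_continuous_evaluation])
  then show "\<forall>x. (\<lambda>n. T n x) \<longlonglongrightarrow> L x"
    by (simp add: o_def)
next
  assume "\<forall>x. (\<lambda>n. T n x) \<longlonglongrightarrow> L x"
  then have "limitin euclidean (\<lambda>n. blinfun_apply (T n)) (blinfun_apply L) sequentially"
    unfolding euclidean_product_topology[symmetric] limitin_componentwise by simp
  then show "sot_tendsto T L"
    unfolding sot_tendsto_def limitin_def strong_operator_topology_topspace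
    by (force simp: strong_operator_topology_def openin_pullback_topology)
qed

lemma bounded_bilinear_cinner: "bounded_bilinear cinner"
proof
  show "\<exists>K. \<forall>a b :: 'a. cmod (cinner a b) \<le> norm a * norm b * K"
    using cmod_cinner_le by (intro exI[of _ 1]) auto
qed (simp_all add: cinner_simps scaleR_conv_of_real)

lemmas tendsto_cinner = bounded_bilinear.tendsto[OF bounded_bilinear_cinner]

lemma tendsto_scaleC:
  assumes "(f \<longlongrightarrow> (x :: 'a::complex_inner)) F"
  shows "((\<lambda>n. c *\<^sub>C f n) \<longlongrightarrow> c *\<^sub>C x) F"
proof -
  have "bounded_linear (\<lambda>x :: 'a. c *\<^sub>C x)"
    by (rule bounded_linear_intro[where K = "cmod c"])
      (simp_all add: scaleC_add_right scaleC_scaleR_commute norm_scaleC)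
  then show ?thesis
    using assms by (rule bounded_linear.tendsto)
qed

lemma tendsto_qform:
  assumes "sot_tendsto T L"
  shows "(\<lambda>n. qform (T n) x) \<longlonglongrightarrow> qform L x"
  using assms unfolding sot_tendsto_iff qform_def
  by (intro tendsto_Re tendsto_cinner tendsto_const) auto

text \<open>Pythagoras: \<open>proj D x\<close> is orthogonal to
  \<open>proj E x - proj D x\<close>.\<close>

lemma norm_proj_diff:
  assumes "finite E" "orthonormal E" "D \<subseteq> E"
  shows "(norm (proj E x - proj D x))\<^sup>2 = (norm (proj E x))\<^sup>2 - (norm (proj D x))\<^sup>2"
proof -
  have D: "finite D" "orthonormal D"
    using assms finite_subset unfolding orthonormal_def by blast+
  have "cinner (proj E x) (proj D x) = cinner x (proj D x)"
    by (simp add: positive_ops_adjoint[OF positive_ops_proj] proj_proj_subset assms)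
  also have "\<dots> = cinner (proj D x) (proj D x)"
    by (simp add: positive_ops_adjoint[OF positive_ops_proj] proj_proj_subset[OF D])
  finally have "cinner (proj E x) (proj D x) = cinner (proj D x) (proj D x)" .
  moreover from this have "cinner (proj D x) (proj E x) = cinner (proj D x) (proj D x)"
    by (metis cinner_commute)
  ultimately show ?thesis
    by (simp add: Re_cinner_self[symmetric] cinner_simps)
qed

lemma norm_proj_le:
  assumes "finite E" "orthonormal E"
  shows "norm (proj E x) \<le> norm x"
proof -
  have "(norm (proj E x))\<^sup>2 = qform (proj E) x"
    by (metis Re_cinner_self qform_def positive_ops_adjoint[OF positive_ops_proj]
        proj_proj_subset[OF assms subset_refl])
  also have "\<dots> \<le> (norm x)\<^sup>2"
    using positive_opsD(2)[OF projection_complement(1)[OF positive_ops_proj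
        proj_proj_subset[OF assms subset_refl]], of x]
    by (simp add: qform_diff) (simp add: qform_def Re_cinner_self)
  finally show ?thesis
    by (rule power2_le_imp_le) simp
qed

text \<open>By Pythagoras the squared norms of \<open>proj (E n) y\<close> increase, and they are
  bounded, so the vectors are Cauchy. Linearity, symmetry and idempotence pass to the pointwise
  limit.\<close>

lemma increasing_proj_converges:
  fixes E :: "nat \<Rightarrow> 'a::complex_hilbert_space set"
  assumes fin: "\<And>n. finite (E n)" and orth: "\<And>n. orthonormal (E n)" and sub: "\<And>n. E n \<subseteq> E (Suc n)"
  obtains P where "P \<in> positive_ops" "\<And>y. (\<lambda>n. proj (E n) y) \<longlonglongrightarrow> P y"
    "\<And>y. P (P y) = P y" "\<And>n y. P (proj (E n) y) = proj (E n) y"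
proof -
  have mono: "E m \<subseteq> E n" if "m \<le> n" for m n
    using lift_Suc_mono_le[of E, OF sub that] .
  have "Cauchy (\<lambda>n. proj (E n) y)" for y
  proof -
    let ?g = "\<lambda>n. (norm (proj (E n) y))\<^sup>2"
    have diff: "(norm (proj (E n) y - proj (E m) y))\<^sup>2 = ?g n - ?g m" if "m \<le> n" for m n
      by (rule norm_proj_diff[OF fin orth mono[OF that]])
    have "incseq ?g"
      by (rule incseq_SucI) (metis diff diff_ge_0_iff_ge le_add2 plus_1_eq_Suc zero_le_power2)
    moreover have "bdd_above (range ?g)"
      by (intro bdd_aboveI2[of _ _ "(norm y)\<^sup>2"] power_mono norm_proj_le fin orth) simp
    ultimately have "Cauchy ?g"
      by (metis LIMSEQ_imp_Cauchy LIMSEQ_incseq_SUP)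
    show ?thesis
    proof (rule metric_CauchyI)
      fix e :: real assume "e > 0"
      then obtain N where N: "\<And>m n. m \<ge> N \<Longrightarrow> n \<ge> N \<Longrightarrow> dist (?g m) (?g n) < e\<^sup>2"
        using metric_CauchyD[OF \<open>Cauchy ?g\<close>, of "e\<^sup>2"] by auto
      have *: "dist (proj (E n) y) (proj (E m) y) < e" if "N \<le> m" "m \<le> n" for m n
      proof -
        have "(norm (proj (E n) y - proj (E m) y))\<^sup>2 < e\<^sup>2"
          using N[of n m] that by (simp add: diff dist_real_def)
        then show ?thesis
          using \<open>e > 0\<close> by (simp add: dist_norm power2_less_imp_less)
      qed
      show "\<exists>M. \<forall>m\<ge>M. \<forall>n\<ge>M. dist (proj (E m) y) (proj (E n) y) < e"
        using * by (metis dist_commute nle_le)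
    qed
  qed
  then obtain p where p: "\<And>y. (\<lambda>n. proj (E n) y) \<longlonglongrightarrow> p y"
    unfolding Cauchy_convergent_iff convergent_def by metis
  have "bounded_linear p"
  proof (rule bounded_linear_intro)
    fix x y :: 'a and r :: real
    show "p (x + y) = p x + p y"
      using tendsto_add[OF p p, of x y] p[of "x + y"]
      by (auto simp: blinfun.add_right intro: LIMSEQ_unique)
    show "p (r *\<^sub>R x) = r *\<^sub>R p x"
      using tendsto_scaleR[OF tendsto_const p, of r x] p[of "r *\<^sub>R x"]
      by (auto simp: blinfun.scaleR_right intro: LIMSEQ_unique)
    show "norm (p x) \<le> norm x * 1"
      using norm_proj_le[OF fin orth] tendsto_upperbound[OF tendsto_norm[OF p]] by simp
  qed
  then have P: "blinfun_apply (Blinfun p) = p"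
    by (rule bounded_linear_Blinfun_apply)
  \<comment> \<open>From index \<open>m\<close> on, the sequence defining this limit is
    constant.\<close>
  have absorb: "p (proj (E m) y) = proj (E m) y" for m y
  proof -
    have "\<forall>\<^sub>F n in sequentially. proj (E n) (proj (E m) y) = proj (E m) y"
      using proj_proj_subset[OF fin orth mono] by (auto simp: eventually_sequentially)
    then have "(\<lambda>n. proj (E n) (proj (E m) y)) \<longlonglongrightarrow> proj (E m) y"
      by (rule tendsto_eventually)
    then show ?thesis
      using p LIMSEQ_unique by blast
  qed
  \<comment> \<open>Continuity of \<open>p\<close> is applied to \<open>proj (E n) y\<close>, a
    sequence that \<open>p\<close> leaves unchanged.\<close>
  have idem: "p (p y) = p y" for y
    using bounded_linear.tendsto[OF \<open>bounded_linear p\<close> p, of y] p[of y]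
    by (simp add: absorb LIMSEQ_unique)
  have "clinear_op (Blinfun p)"
    unfolding clinear_op_def P
  proof (intro allI)
    fix c x
    show "p (c *\<^sub>C x) = c *\<^sub>C p x"
      using tendsto_scaleC[OF p, of c x] p[of "c *\<^sub>C x"]
      by (auto simp: blinfun_scaleC positive_opsD(1)[OF positive_ops_proj] intro: LIMSEQ_unique)
  qed
  moreover have "cinner (p x) y = cinner x (p y)" for x y
    using tendsto_cinner[OF p tendsto_const, of x y] tendsto_cinner[OF tendsto_const p, of x y]
    by (simp add: positive_ops_adjoint[OF positive_ops_proj] LIMSEQ_unique)
  ultimately have "Blinfun p \<in> positive_ops"
    using idem by (intro positive_ops_projection(1)) (simp_all add: P)
  then show thesis
    using that[of "Blinfun p"] p idem absorb by (simp add: P)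
qed

section \<open>Invariant projections and compressed forms\<close>

text \<open>The span of \<open>E (Suc n)\<close> contains \<open>x\<close> and the images of
  \<open>E n\<close> under \<open>A\<close> and \<open>B\<close>. The union of these spans is
  invariant, and \<open>P\<close> projects onto its closure.\<close>

lemma invariant_projection_tower:
  fixes x :: "'a::complex_hilbert_space"
  assumes "A \<in> positive_ops" "B \<in> positive_ops"
  obtains E P where "\<And>n :: nat. finite (E n)" "\<And>n. orthonormal (E n)" "\<And>n. E n \<subseteq> E (Suc n)"
    "\<And>n. proj (E n) x = x" "P \<in> positive_ops" "\<And>y. (\<lambda>n. proj (E n) y) \<longlonglongrightarrow> P y"
    "\<And>y. P (P y) = P y" "\<And>y. P (A (P y)) = A (P y)" "\<And>y. P (B (P y)) = B (P y)"
proof -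
  have "\<exists>E. \<forall>n. (finite (E n) \<and> orthonormal (E n) \<and> proj (E n) x = x) \<and>
    (E n \<subseteq> E (Suc n) \<and> (\<forall>e\<in>E n. proj (E (Suc n)) (A e) = A e \<and> proj (E (Suc n)) (B e) = B e))"
  proof (rule dependent_nat_choice, goal_cases)
    case 1
    show ?case
      using orthonormal_extend[of "{x}" "{}"] by (auto simp: orthonormal_def)
  next
    case (2 D n)
    have "finite (insert x (blinfun_apply A ` D \<union> blinfun_apply B ` D))"
      using 2 by simp
    from orthonormal_extend[OF this, of D] 2 obtain D' where
      "D \<subseteq> D' \<and> finite D' \<and> orthonormal D' \<and>
       (\<forall>v\<in>insert x (blinfun_apply A ` D \<union> blinfun_apply B ` D). proj D' v = v)"
      by blast
    then show ?case
      by (intro exI[of _ D']) auto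
  qed
  then obtain E where E: "\<And>n :: nat. finite (E n)" "\<And>n. orthonormal (E n)" "\<And>n. E n \<subseteq> E (Suc n)"
    "\<And>n. proj (E n) x = x"
    and inv: "\<And>n e. e \<in> E n \<Longrightarrow> proj (E (Suc n)) (A e) = A e \<and> proj (E (Suc n)) (B e) = B e"
    by metis
  obtain P where P: "P \<in> positive_ops" "\<And>y. (\<lambda>n. proj (E n) y) \<longlonglongrightarrow> P y"
    "\<And>y. P (P y) = P y" "\<And>n y. P (proj (E n) y) = proj (E n) y"
    using increasing_proj_converges[of E] E(1-3) by metis
  have "P (T (P y)) = T (P y)"
    if T: "T \<in> positive_ops" and *: "\<And>n e. e \<in> E n \<Longrightarrow> proj (E (Suc n)) (T e) = T e" for T y
  proof -
    \<comment> \<open>\<open>T\<close> maps the span of \<open>E n\<close> into that of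
      \<open>E (Suc n)\<close>, which \<open>P\<close> fixes; continuity carries this over to the
      limit.\<close>
    have "(proj (E (Suc n)) o\<^sub>L T) (proj (E n) y) = T (proj (E n) y)" for n
      by (rule eq_on_proj)
        (auto simp: * positive_opsD(1) positive_ops_proj T intro!: clinear_op_compose)
    then have "P (T (proj (E n) y)) = T (proj (E n) y)" for n
      by (metis P(4) blinfun_apply_blinfun_compose)
    moreover have "(\<lambda>n. P (T (proj (E n) y))) \<longlonglongrightarrow> P (T (P y))"
      "(\<lambda>n. T (proj (E n) y)) \<longlonglongrightarrow> T (P y)"
      by (intro blinfun.tendsto tendsto_const P(2))+
    ultimately show ?thesis
      by (simp add: LIMSEQ_unique)
  qed
  then show thesis
    using that[OF E P(1-3)] assms inv by blast
qed

text \<open>Invariance of the range of \<open>P\<close> makes the symmetric operator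
  \<open>A\<close> block diagonal, so the form at \<open>y\<close> splits without cross
  terms.\<close>

lemma qform_compress_le:
  assumes A: "A \<in> positive_ops" and P: "P \<in> positive_ops"
    and "\<And>y. P (P y) = P y" "\<And>y. P (A (P y)) = A (P y)"
  shows "qform A (P y) \<le> qform A y"
proof -
  have *: "cinner (A (P y)) (y - P y) = 0"
    using assms(3,4) positive_ops_adjoint[OF P, of "A (P y)" "y - P y"]
    by (simp add: blinfun.diff_right)
  then have "cinner (A (y - P y)) (P y) = 0"
    by (metis positive_ops_adjoint[OF A] cinner_commute complex_cnj_zero)
  with * have "qform A (P y + (y - P y)) = qform A (P y) + qform A (y - P y)"
    unfolding qform_def by (simp only: blinfun.add_right cinner_add_left cinner_add_right) simp
  then show ?thesis
    using positive_opsD(2)[OF A, of "y - P y"] by simp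
qed

text \<open>Weighted triangle inequality for the seminorm \<open>sqrt (qform A _)\<close>, applied to
  \<open>Q y = y - (y - Q y)\<close>.\<close>

lemma qform_projection_le:
  assumes A: "A \<in> positive_ops" and Q: "Q \<in> positive_ops" "\<And>y. Q (Q y) = Q y" and "\<epsilon> > 0"
  shows "qform A (Q y) \<le> (1 + \<epsilon>) * qform A y + (1 + 1 / \<epsilon>) * norm A * qform (id_blinfun - Q) y"
proof -
  define r where "r = y - Q y"
  have c: "cinner (A r) y = cnj (cinner (A y) r)"
    by (metis positive_ops_adjoint[OF A] cinner_commute)
  \<comment> \<open>Positivity at \<open>\<epsilon> *\<^sub>R y + r\<close> bounds the cross term
    with weights \<open>\<epsilon>\<close> and \<open>1 / \<epsilon>\<close>.\<close>
  have "0 \<le> qform A (\<epsilon> *\<^sub>R y + r) / \<epsilon>"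
    using positive_opsD(2)[OF A] \<open>\<epsilon> > 0\<close> by simp
  also have "\<dots> = \<epsilon> * qform A y + 2 * Re (cinner (A y) r) + qform A r / \<epsilon>"
    using \<open>\<epsilon> > 0\<close> c
    by (simp add: qform_def blinfun.add_right blinfun.scaleR_right cinner_simps field_simps)
  finally have "- 2 * Re (cinner (A y) r) \<le> \<epsilon> * qform A y + qform A r / \<epsilon>"
    by simp
  moreover have "qform A (y - r) = qform A y - 2 * Re (cinner (A y) r) + qform A r"
    using c by (simp add: qform_def blinfun.diff_right cinner_simps)
  ultimately have "qform A (Q y) \<le> (1 + \<epsilon>) * qform A y + (1 + 1 / \<epsilon>) * qform A r"
    by (simp add: r_def algebra_simps)
  also have "\<dots> \<le> (1 + \<epsilon>) * qform A y + (1 + 1 / \<epsilon>) * (norm A * (norm r)\<^sup>2)"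
    using \<open>\<epsilon> > 0\<close> qform_le[of A r] by (intro add_left_mono mult_left_mono) auto
  finally show ?thesis
    by (simp add: projection_complement(2)[OF Q] r_def mult.assoc)
qed

section \<open>Superadditivity of connections\<close>

text \<open>\<open>R\<close> projects onto a copy of the range of \<open>proj E\<close> orthogonal
  to it. On the sum of the two ranges \<open>C\<close> is the block matrix with all four entries 1,
  which is positive although the swap is not.\<close>

lemma swap_operators:
  assumes "infinite_dimensional TYPE('a::complex_inner)" "finite E" "orthonormal (E :: 'a set)"
  obtains R C where "R \<in> positive_ops" "C \<in> positive_ops"
    "\<And>y. R (R y) = R y" "\<And>y. proj E (R y) = 0"
    "\<And>y. proj E (C (proj E y)) = proj E y"
    "\<And>y. C (proj E y) = proj E y + R (C (proj E y))"
    "\<And>y. proj E (C (R (C (proj E y)))) = proj E y"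
proof -
  obtain F where F: "finite F" "card F = card E" "E \<inter> F = {}" "orthonormal (E \<union> F)"
    using orthonormal_disjoint_copy[OF assms] by blast
  then obtain h where h: "bij_betw h E F"
    using finite_same_card_bij assms(2) by metis
  define Q R C where "Q = proj E" and "R = proj F" and "C = (\<Sum>e\<in>E. rank_one (e + h e))"
  have oF: "orthonormal F"
    using F by (auto simp: orthonormal_def)
  have pos: "Q \<in> positive_ops" "R \<in> positive_ops" "C \<in> positive_ops"
    unfolding Q_def R_def C_def
    by (intro positive_ops_proj positive_ops_sum positive_ops_rank_one)+
  note lin = pos[THEN positive_opsD(1)]
  have hF: "h e \<in> F" if "e \<in> E" for e
    using h that by (auto simp: bij_betw_def)
  have ip: "cinner e f = (if e = f then 1 else 0)" if "e \<in> E \<union> F" "f \<in> E \<union> F" for e f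
    using F(4) that by (auto simp: orthonormal_def)
  have QE: "Q e = e" "R e = 0" if "e \<in> E" for e
    using that F assms oF
    by (auto simp: Q_def R_def proj_fix ip intro!: proj_orthogonal)
  have RF: "R f = f" "Q f = 0" if "f \<in> F" for f
    using that F assms oF
    by (auto simp: Q_def R_def proj_fix ip intro!: proj_orthogonal)
  have C: "C e = e + h e" "C (h e) = e + h e" if "e \<in> E" for e
  proof -
    \<comment> \<open>Since \<open>h\<close> is injective and \<open>E\<close>, \<open>F\<close> are
      disjoint, only the summand for \<open>e\<close> acts on \<open>e\<close> and
      \<open>h e\<close>.\<close>
    have he: "h e' = h e \<longleftrightarrow> e' = e" "h e' \<noteq> e" "h e \<noteq> e'" if "e' \<in> E" for e'
      using h F(3) \<open>e \<in> E\<close> that hF by (auto simp: bij_betw_def inj_on_eq_iff)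
    have "rank_one (e' + h e') e = (if e' = e then e + h e else 0)"
      "rank_one (e' + h e') (h e) = (if e' = e then e + h e else 0)" if "e' \<in> E" for e'
      using he[OF that] he(2)[of e] that \<open>e \<in> E\<close> hF
      by (auto simp: rank_one.rep_eq cinner_add_right ip)
    then show "C e = e + h e" "C (h e) = e + h e"
      using \<open>e \<in> E\<close> assms(2) by (simp_all add: C_def blinfun.sum_left)
  qed
  have eqE: "S (Q y) = T (Q y)"
    if "clinear_op S" "clinear_op T" "\<And>e. e \<in> E \<Longrightarrow> S e = T e" for S T y
    unfolding Q_def by (rule eq_on_proj[OF that])
  have "R (R y) = R y" for y
    unfolding R_def by (rule proj_proj_subset[OF F(1) oF subset_refl])
  moreover have "Q (R y) = 0" for y
  proof -
    have "Q (proj F y) = (0 :: 'a \<Rightarrow>\<^sub>L 'a) (proj F y)"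
      by (rule eq_on_proj) (auto simp: RF lin positive_opsD(1)[OF positive_ops_zero])
    then show ?thesis
      by (simp add: R_def)
  qed
  moreover have "(Q o\<^sub>L C) (Q y) = id_blinfun (Q y)" for y
    by (rule eqE)
      (auto simp: QE RF C hF blinfun.add_right intro!: clinear_op_compose clinear_op_id lin)
  moreover have "C (Q y) = (id_blinfun + (R o\<^sub>L C)) (Q y)" for y
    by (rule eqE)
      (auto simp: QE RF C hF blinfun.add_right blinfun.add_left
        intro!: clinear_op_add clinear_op_compose clinear_op_id lin)
  moreover have "(Q o\<^sub>L C o\<^sub>L R o\<^sub>L C) (Q y) = id_blinfun (Q y)" for y
    by (rule eqE)
      (auto simp: QE RF C hF blinfun.add_right intro!: clinear_op_compose clinear_op_id lin)
  ultimately show thesis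
    using that[of R C] pos by (simp add: Q_def blinfun.add_left)
qed

context
  fixes \<sigma> :: "'a::complex_hilbert_space op_binary"
  assumes closed: "\<sigma> \<in> positive_ops \<rightarrow> positive_ops \<rightarrow> positive_ops"
    and monotone: "jointly_monotone \<sigma>" and transformer: "transformer_inequality \<sigma>"
begin

lemma connection_positive:
  "A \<in> positive_ops \<Longrightarrow> B \<in> positive_ops \<Longrightarrow> \<sigma> A B \<in> positive_ops"
  using closed by auto

lemma connection_mono:
  assumes "A \<in> positive_ops" "A' \<in> positive_ops" "B \<in> positive_ops" "B' \<in> positive_ops"
    and "\<And>y. qform A y \<le> qform A' y" "\<And>y. qform B y \<le> qform B' y"
  shows "qform (\<sigma> A B) x \<le> qform (\<sigma> A' B') x"
  using assms monotone unfolding jointly_monotone_def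
  by (metis connection_positive op_le_iff)

text \<open>In this form each congruence strips one factor \<open>C\<close> from the vector, so
  several can be chained.\<close>

lemma connection_transformer:
  assumes "A \<in> positive_ops" "B \<in> positive_ops" "C \<in> positive_ops"
  shows "qform (\<sigma> A B) (C x) \<le> qform (\<sigma> (congr_op C A) (congr_op C B)) x"
  using assms transformer op_le_iff[of "congr_op C (\<sigma> A B)" "\<sigma> (congr_op C A) (congr_op C B)"]
  by (simp add: transformer_inequality_def positive_ops_congr connection_positive qform_congr[symmetric])

text \<open>Direct sum argument: a copy of \<open>(A2, B2)\<close> is placed on the range of \<open>R\<close>, orthogonal to
  the range of \<open>Q\<close>. The operator \<open>C\<close>, which plays the role of the swap plus the identity, folds
  the direct sum back onto the range of \<open>Q\<close>. Only positive operators occur in the congruences,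
  so the transformer inequality applies.\<close>

lemma connection_superadditive_on_range:
  assumes A: "A1 \<in> positive_ops" "A2 \<in> positive_ops" "B1 \<in> positive_ops" "B2 \<in> positive_ops"
    and pos: "Q \<in> positive_ops" "R \<in> positive_ops" "C \<in> positive_ops"
    and QQ: "\<And>y. Q (Q y) = Q y" and RR: "\<And>y. R (R y) = R y" and QR: "\<And>y. Q (R y) = 0"
    and QCQ: "\<And>y. Q (C (Q y)) = Q y" and CQ: "\<And>y. C (Q y) = Q y + R (C (Q y))"
    and QCRCQ: "\<And>y. Q (C (R (C (Q y)))) = Q y"
  shows "qform (\<sigma> A1 B1) (Q x) + qform (\<sigma> A2 B2) (Q x)
    \<le> qform (\<sigma> (congr_op Q (A1 + A2)) (congr_op Q (B1 + B2))) x"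
proof -
  \<comment> \<open>\<open>d T\<close> is the copy of \<open>congr_op Q T\<close> transported by
    \<open>C\<close> to the range of \<open>R\<close>.\<close>
  define d where "d = (\<lambda>T. congr_op R (congr_op C (congr_op Q T)))"
  define a where "a = congr_op Q A1 + d A2"
  define b where "b = congr_op Q B1 + d B2"
  define X where "X = \<sigma> a b"
  define u where "u = Q x"
  define v where "v = R (C (Q x))"
  have d: "d T \<in> positive_ops" if "T \<in> positive_ops" for T
    unfolding d_def by (intro positive_ops_congr pos that)
  have ab: "a \<in> positive_ops" "b \<in> positive_ops"
    unfolding a_def b_def by (intro positive_ops_add positive_ops_congr d pos A)+
  have X: "X \<in> positive_ops"
    unfolding X_def by (intro connection_positive ab)
  \<comment> \<open>\<open>QCQ = Q\<close> folds the first block and \<open>QCRCQ = Q\<close> the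
    second, so the blocks add up.\<close>
  have fold: "congr_op Q (congr_op C (congr_op Q S + d T)) = congr_op Q (S + T)" for S T
    by (rule blinfun_eqI)
      (simp add: d_def blinfun.add_left blinfun.add_right QCQ QCRCQ)
  have compress: "congr_op Q (congr_op Q S + d T) = congr_op Q S" for S T
    by (rule blinfun_eqI)
      (simp add: d_def blinfun.add_left blinfun.add_right QQ QR)
  have le: "qform (congr_op Q S) y \<le> qform (congr_op Q S + d T) y"
    "qform (d T) y \<le> qform (congr_op Q S + d T) y"
    if "S \<in> positive_ops" "T \<in> positive_ops" for S T y
    using positive_opsD(2)[OF d[OF that(2)]] positive_opsD(2)[OF positive_ops_congr[OF pos(1) that(1)]]
    by (simp_all add: qform_add)
  have corner: "qform (\<sigma> (congr_op Q A1) (congr_op Q B1)) y \<le> qform X y" for y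
    unfolding X_def
    by (rule connection_mono)
      (use ab A pos le in \<open>auto simp: a_def b_def positive_ops_congr\<close>)
  \<comment> \<open>\<open>Q\<close> maps the whole line to \<open>u\<close>, and compressing by
    \<open>Q\<close> leaves only the first block, whose connection lies below \<open>X\<close>.
    Hence \<open>u\<close> minimizes the form on the line.\<close>
  have "qform X u \<le> qform X (u + t *\<^sub>R v)" for t
  proof -
    have "Q (u + t *\<^sub>R v) = u"
      by (simp add: u_def v_def blinfun.add_right blinfun.scaleR_right QQ QR)
    then have "qform X u \<le> qform (\<sigma> (congr_op Q a) (congr_op Q b)) (u + t *\<^sub>R v)"
      unfolding X_def by (metis connection_transformer[OF ab pos(1)])
    also have "\<dots> \<le> qform X (u + t *\<^sub>R v)"
      using corner by (simp add: a_def b_def compress)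
    finally show ?thesis .
  qed
  then have split: "qform X (u + v) = qform X u + qform X v"
    by (rule qform_add_orthogonal[OF X])
  have "qform (\<sigma> A1 B1) (Q x) \<le> qform X u"
    using connection_transformer[OF A(1,3) pos(1), of u] corner[of u] by (simp add: u_def QQ)
  moreover have "qform (\<sigma> A2 B2) (Q x) \<le> qform X v"
  proof -
    \<comment> \<open>Written as \<open>Q (C (R v))\<close>, the vector is reduced to
      \<open>v\<close> by three congruences, with \<open>Q\<close>, \<open>C\<close> and
      \<open>R\<close>; these turn \<open>A2\<close> into \<open>d A2\<close>.\<close>
    have "Q (C (R v)) = Q x"
      by (simp add: v_def RR QCRCQ)
    then have "qform (\<sigma> A2 B2) (Q x) \<le> qform (\<sigma> (congr_op Q A2) (congr_op Q B2)) (C (R v))"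
      by (metis connection_transformer[OF A(2,4) pos(1)])
    also have "\<dots> \<le> qform (\<sigma> (congr_op C (congr_op Q A2)) (congr_op C (congr_op Q B2))) (R v)"
      by (intro connection_transformer positive_ops_congr pos A)
    also have "\<dots> \<le> qform (\<sigma> (d A2) (d B2)) v"
      unfolding d_def by (intro connection_transformer positive_ops_congr pos A)
    also have "\<dots> \<le> qform X v"
      unfolding X_def
      by (rule connection_mono) (use ab A d le in \<open>auto simp: a_def b_def\<close>)
    finally show ?thesis .
  qed
  moreover have "qform X (u + v) \<le> qform (\<sigma> (congr_op Q (A1 + A2)) (congr_op Q (B1 + B2))) x"
  proof -
    \<comment> \<open>Since \<open>C (Q x) = u + v\<close>, congruences with \<open>C\<close> and
      then \<open>Q\<close> fold the direct sum.\<close>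
    have "qform X (C (Q x)) \<le> qform (\<sigma> (congr_op C a) (congr_op C b)) (Q x)"
      unfolding X_def by (intro connection_transformer ab pos)
    also have "\<dots> \<le> qform (\<sigma> (congr_op Q (congr_op C a)) (congr_op Q (congr_op C b))) x"
      by (intro connection_transformer positive_ops_congr ab pos)
    finally show ?thesis
      using CQ[of x] by (simp add: u_def v_def a_def b_def fold)
  qed
  ultimately show ?thesis
    using split by simp
qed

text \<open>The transformer inequality for the scalar operator \<open>1 / sqrt r\<close>, whose
  two-sided product cancels \<open>r\<close>. It later moves \<open>1 + \<epsilon>\<close> out of
  the connection.\<close>

lemma connection_scaleR_le:
  assumes A: "A \<in> positive_ops" "B \<in> positive_ops" and "r > 0"
  shows "qform (\<sigma> (r *\<^sub>R A) (r *\<^sub>R B)) x \<le> r * qform (\<sigma> A B) x"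
proof -
  define C :: "'a \<Rightarrow>\<^sub>L 'a" where "C = (1 / sqrt r) *\<^sub>R id_blinfun"
  have C: "C \<in> positive_ops"
    unfolding C_def using \<open>r > 0\<close> by (intro positive_ops_scaleR positive_ops_id) simp
  have c: "congr_op C (r *\<^sub>R T) = T" for T
    using \<open>r > 0\<close>
    by (intro blinfun_eqI)
      (simp add: C_def blinfun.scaleR_left blinfun.scaleR_right)
  have "qform (\<sigma> (r *\<^sub>R A) (r *\<^sub>R B)) (C x) \<le> qform (\<sigma> A B) x"
    using connection_transformer[of "r *\<^sub>R A" "r *\<^sub>R B" C x] A C \<open>r > 0\<close>
    by (simp add: c positive_ops_scaleR)
  moreover have "C x = (1 / sqrt r) *\<^sub>R x"
    by (simp add: C_def blinfun.scaleR_left)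
  ultimately show ?thesis
    using \<open>r > 0\<close> by (simp add: qform_scaleR_arg power_divide field_simps)
qed

text \<open>The compressions by \<open>Q\<^sub>n = proj (E n)\<close> are dominated by the decreasing
  sequence \<open>(1 + \<epsilon>) A + c (1 - Q\<^sub>n)\<close>, whose limit \<open>(1 + \<epsilon>) A + c (1 - P)\<close> becomes at most
  \<open>(1 + \<epsilon>) A\<close> after compression by \<open>P\<close>.\<close>

lemma connection_superadditive:
  assumes inf: "infinite_dimensional TYPE('a)" and cont: "decreasing_continuous \<sigma>"
    and A12: "A1 \<in> positive_ops" "A2 \<in> positive_ops" "B1 \<in> positive_ops" "B2 \<in> positive_ops"
  shows "qform (\<sigma> A1 B1) x + qform (\<sigma> A2 B2) x \<le> qform (\<sigma> (A1 + A2) (B1 + B2)) x"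
proof -
  define A where "A = A1 + A2"
  define B where "B = B1 + B2"
  have AB: "A \<in> positive_ops" "B \<in> positive_ops"
    unfolding A_def B_def by (intro positive_ops_add A12)+
  obtain E P where fin: "\<And>n :: nat. finite (E n)" and orth: "\<And>n. orthonormal (E n)"
    and sub: "\<And>n. E n \<subseteq> E (Suc n)" and fix_x: "\<And>n. proj (E n) x = x"
    and P: "P \<in> positive_ops" and lim: "\<And>y. (\<lambda>n. proj (E n) y) \<longlonglongrightarrow> P y"
    and PP: "\<And>y. P (P y) = P y"
    and inv: "\<And>y. P (A (P y)) = A (P y)" "\<And>y. P (B (P y)) = B (P y)"
    using invariant_projection_tower[OF AB, of x] by blast
  have Px: "P x = x"
    using lim[of x] by (simp add: fix_x LIMSEQ_const_iff)
  let ?s = "qform (\<sigma> A1 B1) x + qform (\<sigma> A2 B2) x"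
  have le: "?s \<le> (1 + \<epsilon>) * qform (\<sigma> A B) x" if "\<epsilon> > 0" for \<epsilon>
  proof -
    \<comment> \<open>The sum of norms makes one constant serve for both \<open>A\<close> and
      \<open>B\<close> in the projection estimate.\<close>
    define c where "c = (1 + 1 / \<epsilon>) * (norm A + norm B)"
    have c: "c \<ge> 0"
      using that by (simp add: c_def)
    define G where "G = (\<lambda>Q T. (1 + \<epsilon>) *\<^sub>R T + c *\<^sub>R (id_blinfun - Q :: 'a \<Rightarrow>\<^sub>L 'a))"
    have idem: "proj (E n) (proj (E n) y) = proj (E n) y" for n y
      by (rule proj_proj_subset[OF fin orth subset_refl])
    have G_pos: "G Q T \<in> positive_ops"
      if "T \<in> positive_ops" "Q \<in> positive_ops" "\<And>y. Q (Q y) = Q y" for T Q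
      unfolding G_def using \<open>\<epsilon> > 0\<close> c
      by (intro positive_ops_add positive_ops_scaleR projection_complement(1) that) auto
    have G_dec: "sot_decreasing_to (\<lambda>n. G (proj (E n)) T) (G P T)" for T
      unfolding sot_decreasing_to_def sot_tendsto_iff
    proof (intro conjI allI)
      fix n
      \<comment> \<open>Successive terms differ by \<open>c\<close> times the projection onto the
        newly added basis vectors, which is positive.\<close>
      have "proj (E (Suc n)) - proj (E n) = proj (E (Suc n) - E n)"
        unfolding proj_def using sum_diff[OF fin sub, of rank_one n] by simp
      moreover have "G (proj (E n)) T - G (proj (E (Suc n))) T
          = c *\<^sub>R (proj (E (Suc n)) - proj (E n))"
        by (simp add: G_def algebra_simps)
      ultimately show "G (proj (E (Suc n))) T \<preceq> G (proj (E n)) T"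
        unfolding op_le_def by (simp add: positive_ops_scaleR positive_ops_proj c)
    next
      fix y
      show "(\<lambda>n. G (proj (E n)) T y) \<longlonglongrightarrow> G P T y"
        unfolding G_def blinfun.add_left blinfun.scaleR_left blinfun.diff_left
        by (intro tendsto_intros lim)
    qed
    have bound: "?s \<le> qform (\<sigma> (G (proj (E n)) A) (G (proj (E n)) B)) x" for n
    proof -
      obtain R C where RC: "R \<in> positive_ops" "C \<in> positive_ops"
        "\<And>y. R (R y) = R y" "\<And>y. proj (E n) (R y) = 0"
        "\<And>y. proj (E n) (C (proj (E n) y)) = proj (E n) y"
        "\<And>y. C (proj (E n) y) = proj (E n) y + R (C (proj (E n) y))"
        "\<And>y. proj (E n) (C (R (C (proj (E n) y)))) = proj (E n) y"
        using swap_operators[OF inf fin orth, of n] by blast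
      have "?s \<le> qform (\<sigma> (congr_op (proj (E n)) A) (congr_op (proj (E n)) B)) x"
        using connection_superadditive_on_range[OF A12 positive_ops_proj RC(1,2) idem RC(3-7), of x]
        by (simp only: A_def B_def fix_x)
      also have "\<dots> \<le> qform (\<sigma> (G (proj (E n)) A) (G (proj (E n)) B)) x"
      proof -
        have "qform (congr_op (proj (E n)) T) y \<le> qform (G (proj (E n)) T) y"
          if T: "T \<in> positive_ops" "norm T \<le> norm A + norm B" for T y
        proof -
          have "qform T (proj (E n) y) \<le> (1 + \<epsilon>) * qform T y
              + (1 + 1 / \<epsilon>) * norm T * qform (id_blinfun - proj (E n)) y"
            by (intro qform_projection_le T positive_ops_proj idem \<open>\<epsilon> > 0\<close>)
          also have "\<dots> \<le> (1 + \<epsilon>) * qform T y + c * qform (id_blinfun - proj (E n)) y"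
            unfolding c_def using \<open>\<epsilon> > 0\<close> T(2)
              positive_opsD(2)[OF projection_complement(1)[OF positive_ops_proj idem]]
            by (intro add_left_mono mult_right_mono mult_left_mono) auto
          finally show ?thesis
            by (simp add: G_def qform_add qform_scaleR qform_congr positive_ops_proj)
        qed
        then show ?thesis
          using AB by (intro connection_mono positive_ops_congr G_pos positive_ops_proj idem) auto
      qed
      finally show ?thesis .
    qed
    have "sot_tendsto (\<lambda>n. \<sigma> (G (proj (E n)) A) (G (proj (E n)) B)) (\<sigma> (G P A) (G P B))"
    proof -
      have "sot_decreasing_to (\<lambda>n. \<sigma> (G (proj (E n)) A) (G (proj (E n)) B)) (\<sigma> (G P A) (G P B))"
        using cont[unfolded decreasing_continuous_def, rule_format,
            OF G_pos[OF AB(1) P PP] G_pos[OF AB(2) P PP] _ _ G_dec G_dec]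
          G_pos[OF AB(1) positive_ops_proj idem] G_pos[OF AB(2) positive_ops_proj idem]
        by simp
      then show ?thesis
        by (simp add: sot_decreasing_to_def)
    qed
    \<comment> \<open>Writing \<open>x\<close> as \<open>P x\<close> prepares the congruence with
      \<open>P\<close>.\<close>
    then have "?s \<le> qform (\<sigma> (G P A) (G P B)) (P x)"
      unfolding Px using bound by (intro tendsto_lowerbound[OF tendsto_qform]) auto
    also have "\<dots> \<le> qform (\<sigma> (congr_op P (G P A)) (congr_op P (G P B))) x"
      by (intro connection_transformer G_pos AB P PP)
    also have "\<dots> \<le> qform (\<sigma> ((1 + \<epsilon>) *\<^sub>R A) ((1 + \<epsilon>) *\<^sub>R B)) x"
    proof -
      \<comment> \<open>Compression by \<open>P\<close> annihilates the summand with
        \<open>id_blinfun - P\<close>, and invariance bounds the compressed form of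
        \<open>T\<close>.\<close>
      have "qform (congr_op P (G P T)) y \<le> qform ((1 + \<epsilon>) *\<^sub>R T) y"
        if T: "T \<in> positive_ops" "\<And>y. P (T (P y)) = T (P y)" for T y
      proof -
        have "qform (congr_op P (G P T)) y = (1 + \<epsilon>) * qform T (P y)"
          by (simp add: qform_congr P G_def qform_add qform_scaleR projection_complement(2) PP)
        also have "\<dots> \<le> (1 + \<epsilon>) * qform T y"
          using \<open>\<epsilon> > 0\<close> by (intro mult_left_mono qform_compress_le T P PP) auto
        finally show ?thesis
          by (simp add: qform_scaleR)
      qed
      then show ?thesis
        using \<open>\<epsilon> > 0\<close> AB inv
        by (intro connection_mono positive_ops_congr positive_ops_scaleR G_pos P PP) auto
    qed
    also have "\<dots> \<le> (1 + \<epsilon>) * qform (\<sigma> A B) x"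
      using \<open>\<epsilon> > 0\<close> by (intro connection_scaleR_le AB) auto
    finally show ?thesis .
  qed
  have "((\<lambda>\<epsilon>. (1 + \<epsilon>) * qform (\<sigma> A B) x) \<longlongrightarrow> (1 + 0) * qform (\<sigma> A B) x) (at_right 0)"
    by (intro tendsto_intros)
  moreover have "\<forall>\<^sub>F \<epsilon> in at_right 0. ?s \<le> (1 + \<epsilon>) * qform (\<sigma> A B) x"
    using eventually_at_right_less[of 0] by eventually_elim (rule le)
  ultimately have "?s \<le> (1 + 0) * qform (\<sigma> A B) x"
    by (rule tendsto_lowerbound) simp
  then show ?thesis
    by (simp add: A_def B_def)
qed

end

section \<open>Equivalence of the two systems of axioms\<close>

theorem corollary10p7:
  fixes \<sigma> :: "('a::complex_hilbert_space \<Rightarrow>\<^sub>L 'a) \<Rightarrow> ('a \<Rightarrow>\<^sub>L 'a) \<Rightarrow> ('a \<Rightarrow>\<^sub>L 'a)"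
  assumes "infinite_dimensional TYPE('a)"
    and "\<sigma> \<in> positive_ops \<rightarrow> positive_ops \<rightarrow> positive_ops"
  shows "operator_connection \<sigma> \<longleftrightarrow>
    jointly_concave \<sigma> \<and> transformer_inequality \<sigma> \<and> upper_continuous \<sigma>"
proof
  assume conn: "operator_connection \<sigma>"
  then have "jointly_concave \<sigma>"
    unfolding jointly_concave_def operator_connection_def
    using assms connection_superadditive[of \<sigma>]
    by (auto simp: op_le_iff qform_add positive_ops_add connection_positive)
  then show "jointly_concave \<sigma> \<and> transformer_inequality \<sigma> \<and> upper_continuous \<sigma>"
    using conn
    by (auto simp: operator_connection_def decreasing_continuous_def upper_continuous_def
        sot_decreasing_to_def)
next
  assume R: "jointly_concave \<sigma> \<and> transformer_inequality \<sigma> \<and> upper_continuous \<sigma>"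
  have pos: "\<sigma> A B \<in> positive_ops" if "A \<in> positive_ops" "B \<in> positive_ops" for A B
    using assms(2) that by auto
  have "jointly_monotone \<sigma>"
    unfolding jointly_monotone_def
  proof (intro ballI impI)
    fix A1 A2 B1 B2 :: "'a \<Rightarrow>\<^sub>L 'a"
    assume A: "A1 \<in> positive_ops" "A2 \<in> positive_ops" "B1 \<in> positive_ops" "B2 \<in> positive_ops"
      and "A1 \<preceq> A2" "B1 \<preceq> B2"
    then have D: "A2 - A1 \<in> positive_ops" "B2 - B1 \<in> positive_ops"
      by (simp_all add: op_le_def)
    with A R have "\<sigma> A1 B1 + \<sigma> (A2 - A1) (B2 - B1) \<preceq> \<sigma> (A1 + (A2 - A1)) (B1 + (B2 - B1))"
      unfolding jointly_concave_def by blast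
    then have "\<sigma> A2 B2 - \<sigma> A1 B1 - \<sigma> (A2 - A1) (B2 - B1) \<in> positive_ops"
      by (simp add: op_le_def diff_diff_add)
    then show "\<sigma> A1 B1 \<preceq> \<sigma> A2 B2"
      \<comment> \<open>Adding back the positive operator
        \<open>\<sigma> (A2 - A1) (B2 - B1)\<close> leaves the required difference positive.\<close>
      unfolding op_le_def using positive_ops_add[OF _ pos[OF D]] by fastforce
  qed
  \<comment> \<open>Upper continuity gives the limit; monotonicity supplies the decrease of the
    values.\<close>
  moreover from this have "decreasing_continuous \<sigma>"
    using R unfolding decreasing_continuous_def upper_continuous_def jointly_monotone_def
    by (simp add: sot_decreasing_to_def)
  ultimately show "operator_connection \<sigma>"
    using R assms(2) by (simp add: operator_connection_def)
qed

end
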